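(* Let $\mathbb F_q$ be a finite field of characteristic two. Of all the $q^3(q^2-1)$ distinct quadratic rational expressions over $\mathbb F_q$, precisely $q(q^2-1)$ are equivalent (over $\mathbb F_q$) to $x^2$, and precisely $q(q^2-1)^2$ are equivalent (over $\mathbb F_q$) to $(x^2+1)/x$.
   Context: A rational expression $R(x)=g(x)/h(x)\in K(x)$ with $g,h$ coprime has degree $\max(\deg g,\deg h)$; quadratic means degree $2$. The group $G(K)=\mathrm{PGL}_2(K)\times\mathrm{PGL}_2(K)$, with $\mathrm{PGL}_2(K)$ identified with the group of degree-one rational expressions (Möbius transformations) under composition, acts on $K(x)$ by $(B,A)\cdot R(x)=B(R(A^{-1}(x)))$. Two rational expressions are called equivalent (over $K$) if they lie in the same $G(K)$-orbit. *)

theory Defs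
  imports "HOL-Computational_Algebra.Computational_Algebra" "HOL-Algebra.Group_Action"
begin

text \<open>The field of rational expressions over \<open>'a\<close> is \<open>'a poly fract\<close>.\<close>

definition rat_X :: "'a::field poly fract" where
  "rat_X = to_fract [:0, 1:]"

text \<open>\<open>is_reduced f g h\<close>: \<open>f = g / h\<close> in lowest terms. Such \<open>g\<close> and \<open>h\<close> exist and are
  unique up to a common nonzero constant factor, so the definite descriptions below
  are meaningful; see \<open>rat_degree_eq\<close>, \<open>rat_compose_eq\<close> and \<open>ex_reduced\<close>.\<close>

definition is_reduced :: "'a::field poly fract \<Rightarrow> 'a poly \<Rightarrow> 'a poly \<Rightarrow> bool" where
  "is_reduced f g h \<longleftrightarrow> h \<noteq> 0 \<and> coprime g h \<and> f = Fract g h"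

definition rat_degree :: "'a::field poly fract \<Rightarrow> nat" where
  "rat_degree f = (THE d. \<exists>g h. is_reduced f g h \<and> d = max (degree g) (degree h))"

definition eval_fract :: "'a::field poly \<Rightarrow> 'a poly fract \<Rightarrow> 'a poly fract" where
  "eval_fract p s = poly (map_poly (\<lambda>c. to_fract [:c:]) p) s"

text \<open>\<open>rat_compose f s\<close> is \<open>f(s(x))\<close>. If \<open>s\<close> is a constant pole of \<open>f\<close>, the value
  \<open>\<infinity>\<close> is not an element of the field and the result is \<open>0\<close> by the convention for division;
  for non-constant \<open>s\<close> the denominator never vanishes.\<close>

definition rat_compose :: "'a::field poly fract \<Rightarrow> 'a poly fract \<Rightarrow> 'a poly fract" where
  "rat_compose f s = (THE t. \<exists>g h. is_reduced f g h \<and> t = eval_fract g s / eval_fract h s)"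

definition PGL2 :: "'a::field poly fract monoid" where
  "PGL2 = \<lparr>carrier = {f. rat_degree f = 1}, mult = rat_compose, one = rat_X\<rparr>"

definition mobius_act ::
    "'a::field poly fract \<times> 'a poly fract \<Rightarrow> 'a poly fract \<Rightarrow> 'a poly fract" where
  "mobius_act = (\<lambda>(B, A) f. rat_compose B (rat_compose f (inv\<^bsub>PGL2\<^esub> A)))"

definition rat_equiv :: "'a::field poly fract \<Rightarrow> 'a poly fract \<Rightarrow> bool" where
  "rat_equiv f g \<longleftrightarrow>
     (\<exists>\<Omega> \<in> orbits (PGL2 \<times>\<times> PGL2) UNIV mobius_act. f \<in> \<Omega> \<and> g \<in> \<Omega>)"

lemma coprime_poly_bezout:
  fixes g h :: "'a::field poly"
  assumes "coprime g h" "h \<noteq> 0"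
  shows "\<exists>u v. u * g + v * h = 1"
proof -
  define P where "P = (\<lambda>d. d \<noteq> 0 \<and> (\<exists>u v. d = u * g + v * h))"
  have "h = 0 * g + 1 * h" by simp
  then have "P h" unfolding P_def using assms(2) by blast
  then obtain d where d: "P d" "\<And>e. P e \<Longrightarrow> degree d \<le> degree e"
    using ex_has_least_nat[of P h degree] by blast
  then obtain u v where uv: "d \<noteq> 0" "d = u * g + v * h" by (auto simp: P_def)
  have dvd: "d dvd u' * g + v' * h" for u' v'
  proof (rule ccontr)
    let ?y = "u' * g + v' * h"
    assume "\<not> d dvd ?y"
    then have nz: "?y mod d \<noteq> 0" by (simp add: mod_eq_0_iff_dvd)
    define k where "k = ?y div d"
    have "?y mod d = ?y - k * d" by (simp add: minus_div_mult_eq_mod k_def)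
    also have "k * d = k * (u * g + v * h)" using uv(2) by simp
    also have "?y - \<dots> = (u' - k * u) * g + (v' - k * v) * h"
      by (simp add: algebra_simps)
    finally have "P (?y mod d)" using nz unfolding P_def by blast
    then show False using d(2) degree_mod_less'[OF uv(1) nz] by fastforce
  qed
  from dvd[of 1 0] dvd[of 0 1] have "d dvd g" "d dvd h" by simp_all
  with assms(1) have "is_unit d" by (meson coprime_common_divisor)
  then obtain e where "1 = d * e" by (auto elim: dvdE)
  then have "(e * u) * g + (e * v) * h = 1" using uv(2) by (simp add: algebra_simps)
  then show ?thesis by blast
qed

lemma is_reduced_unique:
  assumes "is_reduced f g h" "is_reduced f g' h'"
  shows "\<exists>c. c \<noteq> 0 \<and> g' = smult c g \<and> h' = smult c h"
proof -
  have eq: "g * h' = g' * h" and nz: "h \<noteq> 0" "h' \<noteq> 0"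
    using assms by (auto simp: is_reduced_def eq_fract)
  have dvd: "b dvd b'" if *: "coprime a b" "b \<noteq> 0" "a * b' = a' * b" for a b a' b' :: "'a poly"
  proof -
    obtain u v where "u * a + v * b = 1" using coprime_poly_bezout *(1,2) by blast
    then have "b' = (u * a + v * b) * b'" by simp
    also have "\<dots> = b * (u * a' + v * b')" using *(3) by (simp add: algebra_simps)
    finally show ?thesis by (metis dvd_triv_left)
  qed
  have "h dvd h'" "h' dvd h"
    using assms eq nz by (auto simp: is_reduced_def intro!: dvd[of g h h' g'] dvd[of g' h' h g])
  then obtain k where k: "h' = h * k" "is_unit k"
    using nz by (metis dvdE dvd_mult_cancel_left mult.right_neutral)
  then obtain c where c: "k = [:c:]" "c \<noteq> 0" using k nz by (auto simp: is_unit_poly_iff)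
  have "g' = g * k" using eq k nz by (simp add: mult.commute mult.left_commute)
  then show ?thesis using c k by auto
qed

lemma ex_reduced: "\<exists>g h. is_reduced f g h"
proof -
  define P where "P = (\<lambda>(g, h). h \<noteq> 0 \<and> f = Fract g h)"
  obtain a b where "P (a, b)" unfolding P_def by (cases f) auto
  then obtain y where y: "P y" "\<And>z. P z \<Longrightarrow> degree (snd y) \<le> degree (snd z)"
    using ex_has_least_nat[of P "(a, b)" "degree \<circ> snd"] by auto
  obtain g h where gh: "y = (g, h)" by force
  have h: "h \<noteq> 0" "f = Fract g h" using y(1) by (auto simp: gh P_def)
  have "coprime g h"
  proof (rule coprimeI)
    fix c assume "c dvd g" "c dvd h"
    then obtain g' h' where *: "g = c * g'" "h = c * h'" by (auto elim!: dvdE)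
    then have "c \<noteq> 0" "h' \<noteq> 0" using h by auto
    moreover from this have "P (g', h')" using h * by (auto simp: P_def eq_fract)
    ultimately have "degree h \<le> degree h'" "degree h = degree c + degree h'"
      using y(2)[of "(g', h')"] * by (auto simp: gh degree_mult_eq)
    then show "is_unit c" using \<open>c \<noteq> 0\<close> by (simp add: is_unit_iff_degree)
  qed
  then show ?thesis using h unfolding is_reduced_def by blast
qed

lemma rat_degree_eq:
  assumes "is_reduced f g h"
  shows "rat_degree f = max (degree g) (degree h)"
  unfolding rat_degree_def
proof (rule the_equality)
  show "\<exists>g' h'. is_reduced f g' h' \<and> max (degree g) (degree h) = max (degree g') (degree h')"
    using assms by blast
qed (auto dest!: is_reduced_unique[OF assms])

lemma eval_fract_smult: "eval_fract (smult c p) s = to_fract [:c:] * eval_fract p s"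
proof -
  have "map_poly (\<lambda>c. to_fract [:c:]) (smult c p)
      = smult (to_fract [:c:]) (map_poly (\<lambda>c. to_fract [:c:]) p)"
    by (rule poly_eqI) (simp add: coeff_map_poly flip: to_fract_mult)
  then show ?thesis by (simp add: eval_fract_def)
qed

lemma rat_compose_eq:
  assumes "is_reduced f g h"
  shows "rat_compose f s = eval_fract g s / eval_fract h s"
  unfolding rat_compose_def
proof (rule the_equality)
  show "\<exists>g' h'. is_reduced f g' h' \<and>
      eval_fract g s / eval_fract h s = eval_fract g' s / eval_fract h' s"
    using assms by blast
qed (auto dest!: is_reduced_unique[OF assms] simp: eval_fract_smult)

end

theory Submission
  imports Defs
begin

text \<open>Substituting a nonconstant \<open>s\<close> is a field embedding, because \<open>K\<close> is algebraically closed in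
  \<open>K(x)\<close>; so equivalence of nonconstant \<open>f\<close>, \<open>g\<close> just means \<open>f = B \<circ> g \<circ> A\<close> with \<open>A\<close>, \<open>B\<close> of
  degree one. In characteristic two the orbit of \<open>x\<^sup>2\<close> is \<open>{B \<circ> x\<^sup>2}\<close>, in bijection with the
  expressions of degree one. A quadratic with both linear coefficients zero lies in this orbit; any
  other has exactly one ramification point, and moving it and its image to infinity turns the
  expression into a polynomial equivalent to \<open>x\<^sup>2 + x\<close>. Since \<open>x + 1/x\<close> is not a function of
  \<open>x\<^sup>2\<close>, it belongs to this second orbit, which is therefore the complement of the first.\<close>

section \<open>Constants and evaluation of polynomials at rational expressions\<close>

text \<open>The embedding by which \<open>eval_fract\<close> maps coefficients, named so that
  nonconstancy of \<open>s\<close> can be written \<open>s \<notin> range rat_const\<close>.\<close>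

definition rat_const :: "'a::field \<Rightarrow> 'a poly fract" where
  "rat_const c = to_fract [:c:]"

lemma rat_const_simps [simp]:
  "rat_const 0 = 0" "rat_const 1 = 1"
  by (simp_all add: rat_const_def flip: one_pCons)

lemma rat_const_add: "rat_const (a + b) = rat_const a + rat_const b"
  by (simp add: rat_const_def flip: to_fract_add)

lemma rat_const_2: "rat_const 2 = 2"
  using rat_const_add[of 1 1] by simp

lemma rat_const_diff: "rat_const (a - b) = rat_const a - rat_const b"
  by (simp add: rat_const_def flip: to_fract_diff)

lemma rat_const_mult: "rat_const (a * b) = rat_const a * rat_const b"
  by (simp add: rat_const_def flip: to_fract_mult)

lemma rat_const_power: "rat_const (a ^ n) = rat_const a ^ n"
  by (induction n) (simp_all add: rat_const_mult)

lemma rat_const_eq_iff [simp]: "rat_const a = rat_const b \<longleftrightarrow> a = b"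
  by (simp add: rat_const_def)

lemma rat_const_eq_0_iff [simp]: "rat_const a = 0 \<longleftrightarrow> a = 0"
  using rat_const_eq_iff[of a 0] by (simp del: rat_const_eq_iff)

lemma rat_const_divide: "rat_const (a / b) = rat_const a / rat_const b"
proof (cases "b = 0")
  case False
  then have "rat_const (a / b) * rat_const b = rat_const a"
    by (simp flip: rat_const_mult)
  then show ?thesis using False by (simp add: field_simps)
qed simp

lemma to_fract_pCons: "to_fract (pCons a p) = rat_const a + rat_X * to_fract p"
proof -
  have "pCons a p = [:a:] + [:0, 1:] * p" by simp
  then show ?thesis by (simp only: to_fract_add to_fract_mult rat_const_def rat_X_def)
qed

lemma eval_fract_0 [simp]: "eval_fract 0 s = 0"
  by (simp add: eval_fract_def)

lemma eval_fract_pCons: "eval_fract (pCons a p) s = rat_const a + s * eval_fract p s"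
  by (cases "pCons a p = 0") (auto simp: eval_fract_def rat_const_def map_poly_pCons)

lemma eval_fract_1 [simp]: "eval_fract 1 s = 1"
  by (simp add: one_pCons eval_fract_pCons)

lemma eval_fract_add: "eval_fract (p + r) s = eval_fract p s + eval_fract r s"
proof (induction p arbitrary: r)
  case (pCons a p)
  show ?case
    by (cases r) (simp add: eval_fract_pCons pCons.IH rat_const_add distrib_left)
qed simp

lemma eval_fract_mult: "eval_fract (p * r) s = eval_fract p s * eval_fract r s"
proof (induction p)
  case (pCons a p)
  then show ?case
    by (simp add: eval_fract_pCons eval_fract_add eval_fract_smult rat_const_def algebra_simps)
qed simp

lemma eval_fract_rat_X: "eval_fract p rat_X = to_fract p"
  by (induction p) (simp_all add: eval_fract_pCons to_fract_pCons)

lemma eval_fract_to_fract: "eval_fract p (to_fract g) = to_fract (pcompose p g)"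
  by (induction p) (simp_all add: eval_fract_pCons pcompose_pCons rat_const_def)

text \<open>With \<open>s = g / h\<close>, multiplying by the power of \<open>h\<close> homogenises
  \<open>p\<close>. Every term other than the leading one keeps a factor \<open>h\<close>; these
  terms are collected in \<open>h * r\<close>.\<close>

lemma eval_fract_clear_denominator:
  assumes "s * to_fract h = to_fract g"
  shows "\<exists>r. to_fract h ^ degree p * eval_fract p s
           = to_fract (smult (lead_coeff p) (g ^ degree p) + h * r)"
proof (induction p)
  case 0
  show ?case by (intro exI[of _ 0]) simp
next
  case (pCons a p)
  show ?case
  proof (cases "p = 0")
    case True
    then show ?thesis by (intro exI[of _ 0]) (simp add: eval_fract_pCons rat_const_def)
  next
    case False
    define n where "n = degree p"
    obtain r where r: "to_fract h ^ n * eval_fract p s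
        = to_fract (smult (lead_coeff p) (g ^ n) + h * r)"
      using pCons.IH unfolding n_def by blast
    have "to_fract h ^ Suc n * eval_fract (pCons a p) s
        = to_fract h ^ Suc n * rat_const a
          + (s * to_fract h) * (to_fract h ^ n * eval_fract p s)"
      by (simp add: eval_fract_pCons algebra_simps)
    also have "\<dots> = to_fract (smult a (h ^ Suc n) +
        g * (smult (lead_coeff p) (g ^ n) + h * r))"
    proof -
      have "to_fract h ^ k = to_fract (h ^ k)" for k by (induction k) simp_all
      then have "to_fract h ^ Suc n * rat_const a = to_fract (smult a (h ^ Suc n))"
        by (simp add: rat_const_def flip: to_fract_mult)
      then show ?thesis unfolding r assms by simp
    qed
    also have "smult a (h ^ Suc n) + g * (smult (lead_coeff p) (g ^ n) + h * r)
        = smult (lead_coeff p) (g ^ Suc n) + h * (smult a (h ^ n) + g * r)"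
      by (simp add: algebra_simps)
    finally show ?thesis
      using False n_def by (auto simp del: to_fract_add to_fract_mult)
  qed
qed

text \<open>Rational root argument: if \<open>p\<close> vanished at \<open>s = g / h\<close> in
  lowest terms, \<open>h\<close> would divide a power of \<open>g\<close> and so be a unit. Then
  \<open>s\<close> is a polynomial, and a nonzero \<open>p\<close> cannot vanish after substitution
  of a nonconstant polynomial.\<close>

lemma eval_fract_neq_0:
  assumes s: "s \<notin> range rat_const" and p: "p \<noteq> 0"
  shows "eval_fract p s \<noteq> 0"
proof
  assume 0: "eval_fract p s = 0"
  obtain g h where gh: "is_reduced s g h" using ex_reduced by blast
  then have h: "h \<noteq> 0" "coprime g h" "s = to_fract g / to_fract h"
    by (auto simp: is_reduced_def Fract_conv_to_fract)
  then have sh: "s * to_fract h = to_fract g" by simp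
  obtain r where "smult (lead_coeff p) (g ^ degree p) + h * r = 0"
    using eval_fract_clear_denominator[OF sh, of p] 0
    by (auto simp del: to_fract_add to_fract_mult)
  then have "smult (lead_coeff p) (g ^ degree p) = h * (- r)"
    by (simp add: eq_neg_iff_add_eq_0)
  then have "h dvd smult (lead_coeff p) (g ^ degree p)" by (metis dvd_triv_left)
  then have "h dvd g ^ degree p" using p by (simp add: dvd_smult_iff)
  moreover obtain u v where uv: "u * g + v * h = 1"
    using coprime_poly_bezout h by blast
  \<comment> \<open>Euclid's lemma, read off from the Bezout identity; it strips the factors
    \<open>g\<close> from the power one at a time.\<close>
  have cancel: "h dvd x" if "h dvd g * x" for x
  proof -
    have "x = (u * g + v * h) * x" by (simp add: uv)
    also have "\<dots> = u * (g * x) + (v * x) * h" by (simp only: algebra_simps)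
    finally have "x = \<dots>" .
    moreover have "h dvd \<dots>" by (rule dvd_add[OF dvd_mult[OF that] dvd_triv_right])
    ultimately show ?thesis by simp
  qed
  have "h dvd g ^ n \<Longrightarrow> is_unit h" for n
    by (induction n) (simp, metis cancel power_Suc)
  ultimately have "is_unit h" by blast
  then obtain c where c: "h = [:c:]" "c \<noteq> 0"
    using h(1) by (auto simp: is_unit_poly_iff)
  define k where "k = smult (inverse c) g"
  have "g = k * h" by (simp add: k_def c)
  then have sk: "s = to_fract k" using h by simp
  have "pcompose p k = 0" using 0 by (simp add: sk eval_fract_to_fract)
  then have "degree k = 0" using p pcompose_eq_0 by blast
  then obtain a where "k = [:a:]" using degree_eq_zeroE by blast
  then show False using s sk by (auto simp: rat_const_def)
qed

section \<open>Composition as a field embedding\<close>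

text \<open>Frees composition from the reduced representative: cross-multiplied equations survive
  evaluation at \<open>s\<close>, and no denominator vanishes there. Sums and products can then be
  treated without reducing fractions.\<close>

lemma rat_compose_Fract:
  assumes s: "s \<notin> range rat_const" and h: "h \<noteq> 0"
  shows "rat_compose (Fract g h) s = eval_fract g s / eval_fract h s"
proof -
  obtain g0 h0 where gh: "is_reduced (Fract g h) g0 h0" using ex_reduced by blast
  then have h0: "h0 \<noteq> 0" and eq: "g * h0 = g0 * h"
    using h by (auto simp: is_reduced_def eq_fract)
  have "eval_fract g s * eval_fract h0 s = eval_fract g0 s * eval_fract h s"
    using eq by (metis eval_fract_mult)
  then show ?thesis
    using rat_compose_eq[OF gh, of s] eval_fract_neq_0[OF s] h h0
    by (simp add: frac_eq_eq)
qed

lemma rat_compose_rat_X_right [simp]: "rat_compose f rat_X = f"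
proof -
  obtain g h where "is_reduced f g h" using ex_reduced by blast
  then show ?thesis
    using rat_compose_eq[of f g h rat_X]
    by (simp add: eval_fract_rat_X is_reduced_def Fract_conv_to_fract)
qed

lemma rat_compose_const [simp]: "rat_compose (rat_const c) s = rat_const c"
proof -
  have "is_reduced (rat_const c) [:c:] 1"
    by (simp add: is_reduced_def rat_const_def to_fract_def)
  then show ?thesis by (simp add: rat_compose_eq eval_fract_pCons)
qed

lemma rat_compose_rat_X_left [simp]: "rat_compose rat_X s = s"
proof -
  have "is_reduced rat_X [:0, 1:] 1"
    by (simp add: is_reduced_def rat_X_def to_fract_def)
  then show ?thesis by (subst rat_compose_eq) (assumption, simp add: eval_fract_pCons)
qed

text \<open>At a pole the quotient takes the default value 0, which is a constant too, so poles need
  no separate treatment.\<close>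

lemma rat_compose_of_const: "rat_compose f (rat_const c) \<in> range rat_const"
proof -
  have *: "eval_fract p (rat_const c) = rat_const (poly p c)" for p
    by (induction p) (simp_all add: eval_fract_pCons rat_const_add rat_const_mult)
  obtain g h where "is_reduced f g h" using ex_reduced by blast
  then show ?thesis by (simp add: rat_compose_eq * flip: rat_const_divide)
qed

context
  fixes s :: "'a::field poly fract"
  assumes s: "s \<notin> range rat_const"
begin

lemma rat_compose_add: "rat_compose (f + g) s = rat_compose f s + rat_compose g s"
  by (cases f; cases g)
    (simp add: rat_compose_Fract[OF s] eval_fract_add eval_fract_mult
      eval_fract_neq_0[OF s] add_frac_eq)

lemma rat_compose_mult: "rat_compose (f * g) s = rat_compose f s * rat_compose g s"
  by (cases f; cases g) (simp add: rat_compose_Fract[OF s] eval_fract_mult)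

lemma rat_compose_power: "rat_compose (f ^ n) s = rat_compose f s ^ n"
  using rat_compose_const[of 1 s] by (induction n) (simp_all add: rat_compose_mult)

text \<open>A nonzero \<open>f\<close> has an inverse, and the two images under substitution
  multiply to 1.\<close>

lemma rat_compose_eq_0_iff: "rat_compose f s = 0 \<longleftrightarrow> f = 0"
proof
  assume 0: "rat_compose f s = 0"
  show "f = 0"
  proof (rule ccontr)
    assume "f \<noteq> 0"
    then have "rat_compose f s * rat_compose (inverse f) s = 1"
      using rat_compose_const[of 1 s] by (simp flip: rat_compose_mult)
    with 0 show False by simp
  qed
qed (use rat_compose_const[of 0 s] in simp)

lemma rat_compose_divide: "rat_compose (f / g) s = rat_compose f s / rat_compose g s"
proof (cases "g = 0")
  case False
  then have "rat_compose (f / g) s * rat_compose g s = rat_compose f s"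
    by (simp flip: rat_compose_mult)
  then show ?thesis using False by (simp add: rat_compose_eq_0_iff field_simps)
qed (use rat_compose_const[of 0 s] in simp)

lemma rat_compose_inject: "rat_compose f s = rat_compose g s \<longleftrightarrow> f = g"
proof
  assume "rat_compose f s = rat_compose g s"
  moreover have "rat_compose ((f - g) + g) s = rat_compose (f - g) s + rat_compose g s"
    by (rule rat_compose_add)
  ultimately have "rat_compose (f - g) s = 0" by simp
  then show "f = g" by (simp add: rat_compose_eq_0_iff)
qed simp

lemma rat_compose_nonconst:
  assumes "f \<notin> range rat_const"
  shows "rat_compose f s \<notin> range rat_const"
proof
  assume "rat_compose f s \<in> range rat_const"
  then obtain c where "rat_compose f s = rat_compose (rat_const c) s" by auto
  then have "f = rat_const c" by (simp only: rat_compose_inject)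
  then show False using assms by blast
qed

lemma rat_compose_eval_fract: "rat_compose (eval_fract p t) s = eval_fract p (rat_compose t s)"
  using rat_compose_const[of 0 s]
  by (induction p) (simp_all add: eval_fract_pCons rat_compose_add rat_compose_mult)

text \<open>Substitution of \<open>s\<close> commutes with quotients and with
  \<open>eval_fract\<close>, so it can be pushed down to the argument \<open>t\<close>.\<close>

lemma rat_compose_assoc:
  assumes t: "t \<notin> range rat_const"
  shows "rat_compose (rat_compose f t) s = rat_compose f (rat_compose t s)"
  by (cases f) (simp add: rat_compose_Fract t rat_compose_nonconst rat_compose_divide
      rat_compose_eval_fract)

end

section \<open>Degree zero and degree one: constants and Moebius transformations\<close>

lemma rat_degree_const_iff: "rat_degree f = 0 \<longleftrightarrow> f \<in> range rat_const"
proof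
  assume 0: "rat_degree f = 0"
  obtain g h where gh: "is_reduced f g h" using ex_reduced by blast
  then have "degree g = 0" "degree h = 0" using 0 by (auto simp: rat_degree_eq)
  then obtain a b where "g = [:a:]" "h = [:b:]" by (metis degree_eq_zeroE)
  then have "f = rat_const (a / b)"
    using gh by (simp add: is_reduced_def Fract_conv_to_fract rat_const_divide)
      (simp add: rat_const_def)
  then show "f \<in> range rat_const" by simp
next
  assume "f \<in> range rat_const"
  then obtain c where c: "f = rat_const c" by auto
  have "is_reduced (rat_const c) [:c:] 1"
    by (simp add: is_reduced_def rat_const_def to_fract_def)
  then show "rat_degree f = 0" by (simp add: c rat_degree_eq)
qed

definition mobius :: "'a::field \<Rightarrow> 'a \<Rightarrow> 'a \<Rightarrow> 'a \<Rightarrow> 'a poly fract" where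
  "mobius a b c d = (rat_const a * rat_X + rat_const b) / (rat_const c * rat_X + rat_const d)"

lemma to_fract_linear: "to_fract [:b, a:] = rat_const a * rat_X + rat_const b"
  by (simp add: to_fract_pCons algebra_simps)

lemma mobius_Fract: "mobius a b c d = Fract [:b, a:] [:d, c:]"
  by (simp add: mobius_def Fract_conv_to_fract to_fract_linear)

lemma rat_X_nonconst: "rat_X \<notin> range rat_const"
  by (auto simp: rat_X_def rat_const_def)

lemma linear_nonconst_eq_0_iff:
  assumes "s \<notin> range rat_const"
  shows "rat_const c * s + rat_const d = 0 \<longleftrightarrow> c = 0 \<and> d = 0"
  using eval_fract_neq_0[OF assms, of "[:d, c:]"]
  by (auto simp: eval_fract_pCons algebra_simps)

lemma rat_compose_mobius:
  assumes "s \<notin> range rat_const"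
  shows "rat_compose (mobius a b c d) s
    = (rat_const a * s + rat_const b) / (rat_const c * s + rat_const d)"
  by (simp add: mobius_def assms rat_compose_divide rat_compose_add rat_compose_mult)

text \<open>A common divisor divides a nonzero constant. In the applications this constant is a
  determinant.\<close>

lemma coprime_poly_if_combination_const:
  fixes g h :: "'a::field poly"
  assumes "smult u g + smult v h = [:k:]" "k \<noteq> 0"
  shows "coprime g h"
proof (rule coprimeI)
  fix p assume "p dvd g" "p dvd h"
  then have "p dvd [:k:]" unfolding assms(1)[symmetric] by (intro dvd_add dvd_smult)
  moreover have "is_unit [:k:]" using assms(2) by (simp add: is_unit_poly_iff dvd_field_iff)
  ultimately show "is_unit p" using dvd_trans by blast
qed

lemma rat_degree_mobius:
  assumes det: "a * d - b * c \<noteq> 0"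
  shows "rat_degree (mobius a b c d) = 1"
proof -
  have "smult (- c) [:b, a:] + smult a [:d, c:] = [:a * d - b * c:]"
    by (simp add: algebra_simps)
  then have "coprime [:b, a:] [:d, c:]" using det by (rule coprime_poly_if_combination_const)
  moreover have "[:d, c:] \<noteq> 0" using det by auto
  ultimately have "is_reduced (mobius a b c d) [:b, a:] [:d, c:]"
    by (simp add: is_reduced_def mobius_Fract)
  then show ?thesis using det by (auto simp: rat_degree_eq)
qed

lemma mobius_nonconst:
  "a * d - b * c \<noteq> 0 \<Longrightarrow> mobius a b c d \<notin> range rat_const"
  using rat_degree_mobius[of a d b c] by (simp flip: rat_degree_const_iff)

text \<open>A zero determinant makes numerator and denominator proportional; a vanishing denominator
  gives the constant 0. The argument \<open>y\<close> is arbitrary so that both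
  \<open>y = rat_X\<close> and \<open>y = rat_X ^ 2\<close> are covered.\<close>

lemma linear_quotient_const:
  fixes y :: "'a::field poly fract"
  assumes "a * d - b * c = 0"
  shows "(rat_const a * y + rat_const b) / (rat_const c * y + rat_const d) \<in> range rat_const"
    (is "?f \<in> _")
proof -
  have *: "rat_const a * rat_const d = rat_const b * rat_const c"
    using assms by (simp flip: rat_const_mult)
  consider "c = 0" "d = 0" | "c \<noteq> 0" | "c = 0" "d \<noteq> 0" by blast
  then show ?thesis
  proof cases
    case 1
    then show ?thesis using rangeI[of rat_const 0] by simp
  next
    case 2
    have "?f = rat_const (a / c) \<or> ?f = 0"
    proof (cases "rat_const c * y + rat_const d = 0")
      case False
      have "rat_const c * (rat_const a * y + rat_const b)
          = rat_const a * (rat_const c * y + rat_const d)"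
        using * by (simp add: algebra_simps)
      then show ?thesis using 2 False by (simp add: rat_const_divide frac_eq_eq mult.commute)
    qed simp
    then show ?thesis by (metis rangeI rat_const_simps(1))
  next
    case 3
    then have "a = 0" using assms by simp
    then have "?f = rat_const (b / d)" using 3 by (simp add: rat_const_divide)
    then show ?thesis by simp
  qed
qed

lemma rat_degree_1_iff:
  "rat_degree f = 1 \<longleftrightarrow> (\<exists>a b c d. a * d - b * c \<noteq> 0 \<and> f = mobius a b c d)"
proof
  assume 1: "rat_degree f = 1"
  obtain g h where gh: "is_reduced f g h" using ex_reduced by blast
  have lin: "\<exists>a b. p = [:b, a:]" if "degree p \<le> 1" for p :: "'a poly"
  proof -
    have "p = [:coeff p 0, coeff p 1:]"
      using that by (intro poly_eqI) (auto simp: coeff_pCons coeff_eq_0 split: nat.splits)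
    then show ?thesis by blast
  qed
  from gh 1 have "degree g \<le> 1" "degree h \<le> 1" by (auto simp: rat_degree_eq)
  then obtain a b c d where "g = [:b, a:]" "h = [:d, c:]" using lin by metis
  then have f: "f = mobius a b c d" using gh by (simp add: mobius_Fract is_reduced_def)
  have "f \<notin> range rat_const" using 1 by (simp flip: rat_degree_const_iff)
  then have "a * d - b * c \<noteq> 0" using linear_quotient_const f unfolding mobius_def by blast
  with f show "\<exists>a b c d. a * d - b * c \<noteq> 0 \<and> f = mobius a b c d" by blast
qed (auto simp: rat_degree_mobius)

text \<open>Expanding the fraction by the inner denominator turns composition into the product of
  the coefficient matrices.\<close>

lemma rat_compose_mobius_mobius:
  assumes "a' * d' - b' * c' \<noteq> 0"
  shows "rat_compose (mobius a b c d) (mobius a' b' c' d')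
    = mobius (a * a' + b * c') (a * b' + b * d') (c * a' + d * c') (c * b' + d * d')"
proof -
  have nz: "rat_const c' * rat_X + rat_const d' \<noteq> 0"
    using assms by (auto simp: linear_nonconst_eq_0_iff[OF rat_X_nonconst])
  have "rat_compose (mobius a b c d) (mobius a' b' c' d')
      = ((rat_const a * mobius a' b' c' d' + rat_const b)
          * (rat_const c' * rat_X + rat_const d'))
        / ((rat_const c * mobius a' b' c' d' + rat_const d)
          * (rat_const c' * rat_X + rat_const d'))"
    using nz by (simp add: rat_compose_mobius[OF mobius_nonconst[OF assms]])
  also have "\<dots> = mobius (a * a' + b * c') (a * b' + b * d') (c * a' + d * c') (c * b' + d * d')"
    unfolding mobius_def using nz
    by (simp add: rat_const_add rat_const_mult distrib_right) (simp add: algebra_simps)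
  finally show ?thesis .
qed

lemma mobius_eq_rat_X: "a \<noteq> 0 \<Longrightarrow> mobius a 0 0 a = rat_X"
  by (simp add: mobius_def)

lemma nonconst_if_rat_degree_1: "rat_degree f = 1 \<Longrightarrow> f \<notin> range rat_const"
  by (simp flip: rat_degree_const_iff)

lemma rat_degree_rat_compose_1:
  assumes "rat_degree f = 1" "rat_degree g = 1"
  shows "rat_degree (rat_compose f g) = 1"
proof -
  obtain a b c d where f: "a * d - b * c \<noteq> 0" "f = mobius a b c d"
    using assms(1) unfolding rat_degree_1_iff by blast
  obtain a' b' c' d' where g: "a' * d' - b' * c' \<noteq> 0" "g = mobius a' b' c' d'"
    using assms(2) unfolding rat_degree_1_iff by blast
  \<comment> \<open>Multiplicativity of the determinant.\<close>
  have "(a * a' + b * c') * (c * b' + d * d') - (a * b' + b * d') * (c * a' + d * c')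
      = (a * d - b * c) * (a' * d' - b' * c')"
    by (simp add: algebra_simps)
  then show ?thesis using f g by (simp add: rat_compose_mobius_mobius rat_degree_mobius)
qed

section \<open>The group of Moebius transformations and its orbits\<close>

lemma PGL2_simps [simp]:
  "A \<in> carrier PGL2 \<longleftrightarrow> rat_degree A = 1"
  "mult PGL2 = rat_compose" "one PGL2 = rat_X"
  by (simp_all add: PGL2_def)

lemma rat_degree_rat_X: "rat_degree rat_X = 1"
  using rat_degree_mobius[of 1 1 0 0] by (simp add: mobius_eq_rat_X)

lemma group_PGL2: "group (PGL2 :: 'a::field poly fract monoid)"
proof (rule groupI)
  fix x y z :: "'a poly fract"
  assume "x \<in> carrier PGL2" "y \<in> carrier PGL2" "z \<in> carrier PGL2"
  then show "x \<otimes>\<^bsub>PGL2\<^esub> y \<otimes>\<^bsub>PGL2\<^esub> z = x \<otimes>\<^bsub>PGL2\<^esub> (y \<otimes>\<^bsub>PGL2\<^esub> z)"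
    by (simp add: rat_compose_assoc nonconst_if_rat_degree_1)
next
  fix x :: "'a poly fract"
  assume "x \<in> carrier PGL2"
  then have "rat_degree x = 1" by simp
  then obtain a b c d where x: "a * d - b * c \<noteq> 0" "x = mobius a b c d"
    unfolding rat_degree_1_iff by blast
  \<comment> \<open>The adjugate matrix gives the left inverse: the matrix product is the
    determinant times the identity, and \<open>mobius\<close> ignores the scalar.\<close>
  have "rat_compose (mobius d (- b) (- c) a) x = rat_X"
    using x mobius_eq_rat_X[of "a * d - b * c"]
    by (simp add: rat_compose_mobius_mobius algebra_simps)
  moreover have "rat_degree (mobius d (- b) (- c) a) = 1"
    using x by (intro rat_degree_mobius) (simp add: algebra_simps)
  ultimately show "\<exists>y\<in>carrier PGL2. y \<otimes>\<^bsub>PGL2\<^esub> x = \<one>\<^bsub>PGL2\<^esub>" by auto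
qed (simp_all add: rat_degree_rat_compose_1 rat_degree_rat_X)

text \<open>The orbit of \<open>g\<close> contains \<open>g\<close> through the identity pair and
  the composite through \<open>(B, inv A)\<close>, since \<open>mobius_act\<close> inverts its
  second component.\<close>

lemma rat_equivI:
  fixes g :: "'a::field poly fract"
  assumes "rat_degree B = 1" "rat_degree A = 1"
  shows "rat_equiv (rat_compose B (rat_compose g A)) g"
proof -
  interpret PGL2: group "PGL2 :: 'a poly fract monoid" by (rule group_PGL2)
  let ?\<Omega> = "orbit (PGL2 \<times>\<times> PGL2) mobius_act g"
  have "?\<Omega> \<in> orbits (PGL2 \<times>\<times> PGL2) UNIV mobius_act" by (auto simp: orbits_def)
  moreover have "(B, inv\<^bsub>PGL2\<^esub> A) \<in> carrier (PGL2 \<times>\<times> PGL2)"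
    using assms PGL2.inv_closed[of A] by (simp add: DirProd_def)
  then have "mobius_act (B, inv\<^bsub>PGL2\<^esub> A) g \<in> ?\<Omega>"
    unfolding orbit_def by blast
  moreover have "(rat_X, rat_X) \<in> carrier (PGL2 \<times>\<times> PGL2)"
    by (simp add: DirProd_def rat_degree_rat_X)
  then have "mobius_act (rat_X, rat_X) g \<in> ?\<Omega>"
    unfolding orbit_def by blast
  moreover have "mobius_act (B, inv\<^bsub>PGL2\<^esub> A) g = rat_compose B (rat_compose g A)"
    using assms PGL2.inv_inv[of A] by (simp add: mobius_act_def)
  moreover have "mobius_act (rat_X, rat_X) g = g"
    using PGL2.inv_one by (simp add: mobius_act_def)
  ultimately show ?thesis unfolding rat_equiv_def by metis
qed

text \<open>A common orbit only provides a base point \<open>y\<close> from which both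
  \<open>f\<close> and \<open>g\<close> arise. This \<open>y\<close> is nonconstant because
  \<open>g\<close> is, so compositions may be regrouped and \<open>y\<close> eliminated.\<close>

lemma rat_equivE:
  fixes g :: "'a::field poly fract"
  assumes equiv: "rat_equiv f g" and g: "g \<notin> range rat_const"
  obtains B A where "rat_degree B = 1" "rat_degree A = 1" "f = rat_compose B (rat_compose g A)"
proof -
  interpret PGL2: group "PGL2 :: 'a poly fract monoid" by (rule group_PGL2)
  obtain y B A B' A' where deg: "rat_degree B = 1" "rat_degree A = 1"
      "rat_degree B' = 1" "rat_degree A' = 1"
    and f: "f = rat_compose B (rat_compose y (inv\<^bsub>PGL2\<^esub> A))"
    and g': "g = rat_compose B' (rat_compose y (inv\<^bsub>PGL2\<^esub> A'))"
    using equiv unfolding rat_equiv_def orbits_def orbit_def mobius_act_def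
    by (auto simp: DirProd_def)
  have y: "y \<notin> range rat_const"
  proof
    assume "y \<in> range rat_const"
    then obtain c c' where "rat_compose y (inv\<^bsub>PGL2\<^esub> A') = rat_const c"
      "rat_compose B' (rat_const c) = rat_const c'"
      using rat_compose_of_const by (metis imageE rat_compose_const)
    then show False using g g' by simp
  qed
  \<comment> \<open>Solving for \<open>f\<close>: \<open>C\<close> cancels \<open>B'\<close> on the
    left of \<open>g\<close>, while \<open>D\<close> turns the inverse of \<open>A'\<close> on its
    right into the inverse of \<open>A\<close>.\<close>
  define C D where "C = inv\<^bsub>PGL2\<^esub> B'" and "D = rat_compose A' (inv\<^bsub>PGL2\<^esub> A)"
  have inv: "rat_degree (inv\<^bsub>PGL2\<^esub> Z) = 1" if "rat_degree Z = 1" for Z :: "'a poly fract"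
    using PGL2.inv_closed[of Z] that by simp
  have C: "rat_degree C = 1" and D: "rat_degree D = 1"
    using deg inv by (auto simp: C_def D_def rat_degree_rat_compose_1)
  have "rat_compose C B' = rat_X"
    using PGL2.l_inv[of B'] deg by (simp add: C_def)
  have "rat_compose (inv\<^bsub>PGL2\<^esub> A') D = inv\<^bsub>PGL2\<^esub> A"
    using PGL2.inv_solve_left[of "inv\<^bsub>PGL2\<^esub> A" A' D] deg D inv by (simp add: D_def)
  have "rat_compose (rat_compose B C) (rat_compose g D)
      = rat_compose B (rat_compose (rat_compose C B') (rat_compose y (rat_compose (inv\<^bsub>PGL2\<^esub> A') D)))"
    unfolding g'
    using y deg C D inv
    by (simp add: rat_compose_assoc nonconst_if_rat_degree_1 rat_compose_nonconst)
  also have "\<dots> = f"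
    by (simp add: \<open>rat_compose C B' = rat_X\<close> \<open>rat_compose (inv\<^bsub>PGL2\<^esub> A') D = inv\<^bsub>PGL2\<^esub> A\<close> f)
  finally have "f = rat_compose (rat_compose B C) (rat_compose g D)" by simp
  then show thesis using that[of "rat_compose B C" D] deg C D rat_degree_rat_compose_1 by blast
qed

lemma rat_equiv_sym: "rat_equiv f g \<Longrightarrow> rat_equiv g f"
  unfolding rat_equiv_def by blast

text \<open>The Moebius transformations on either side compose; nonconstancy passes from
  \<open>h\<close> to \<open>g\<close>, so the previous description of equivalence applies
  twice.\<close>

lemma rat_equiv_trans:
  assumes "rat_equiv f g" "rat_equiv g h" and h: "h \<notin> range rat_const"
  shows "rat_equiv f h"
proof -
  obtain B A where BA: "rat_degree B = 1" "rat_degree A = 1" "g = rat_compose B (rat_compose h A)"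
    using rat_equivE[OF assms(2) h] .
  then have "g \<notin> range rat_const"
    using h by (simp add: rat_compose_nonconst nonconst_if_rat_degree_1)
  then obtain B' A' where BA': "rat_degree B' = 1" "rat_degree A' = 1"
    "f = rat_compose B' (rat_compose g A')"
    using rat_equivE[OF assms(1)] by blast
  have "f = rat_compose (rat_compose B' B) (rat_compose h (rat_compose A A'))"
    using BA BA' h
    by (simp add: rat_compose_assoc nonconst_if_rat_degree_1 rat_compose_nonconst)
  then show ?thesis using BA BA' rat_equivI rat_degree_rat_compose_1 by metis
qed

section \<open>Counting rational expressions of given degree\<close>

lemma degree_le_Suc_eq_image:
  "{p :: 'a::zero poly. degree p \<le> Suc n} = case_prod pCons ` (UNIV \<times> {p. degree p \<le> n})"
proof (intro equalityI subsetI)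
  fix p :: "'a poly" assume "p \<in> {p. degree p \<le> Suc n}"
  moreover obtain a r where "p = pCons a r" by (cases p)
  ultimately show "p \<in> case_prod pCons ` (UNIV \<times> {p. degree p \<le> n})"
    by (cases "r = 0") auto
qed (auto simp: degree_pCons_eq_if)

lemma
  fixes n :: nat
  shows card_degree_le: "card {p :: 'a::{zero,finite} poly. degree p \<le> n} = card (UNIV :: 'a set) ^ Suc n"
    and finite_degree_le: "finite {p :: 'a poly. degree p \<le> n}"
proof (induction n)
  case 0
  have "{p :: 'a poly. degree p \<le> 0} = range (\<lambda>a. [:a:])"
    by (auto elim: degree_eq_zeroE)
  moreover have "inj (\<lambda>a :: 'a. [:a:])" by (auto intro: injI)
  ultimately show "card {p :: 'a poly. degree p \<le> 0} = card (UNIV :: 'a set) ^ Suc 0"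
    and "finite {p :: 'a poly. degree p \<le> 0}"
    by (simp_all add: card_image)
next
  case (Suc n)
  have "inj_on (case_prod pCons) (UNIV \<times> {p :: 'a poly. degree p \<le> n})"
    by (auto intro!: inj_onI)
  then show "card {p :: 'a poly. degree p \<le> Suc n} = card (UNIV :: 'a set) ^ Suc (Suc n)"
    and "finite {p :: 'a poly. degree p \<le> Suc n}"
    unfolding degree_le_Suc_eq_image using Suc by (simp_all add: card_image)
qed

lemma card_degree_le_nonzero:
  "card {p :: 'a::{zero,finite} poly. p \<noteq> 0 \<and> degree p \<le> n} = card (UNIV :: 'a set) ^ Suc n - 1"
proof -
  have "{p :: 'a poly. p \<noteq> 0 \<and> degree p \<le> n} = {p. degree p \<le> n} - {0}" by auto
  then show ?thesis
    by (simp add: card_Diff_singleton finite_degree_le card_degree_le del: power_Suc)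
qed

lemma finite_rat_degree_eq: "finite {f :: 'a::{field,finite} poly fract. rat_degree f = e}"
proof (rule finite_subset)
  let ?P = "{p :: 'a poly. degree p \<le> e}"
  show "{f :: 'a poly fract. rat_degree f = e} \<subseteq> case_prod Fract ` (?P \<times> ?P)"
  proof
    fix f :: "'a poly fract" assume f: "f \<in> {f. rat_degree f = e}"
    obtain g h where gh: "is_reduced f g h" using ex_reduced by blast
    then have "(g, h) \<in> ?P \<times> ?P" using f by (auto simp: rat_degree_eq)
    then show "f \<in> case_prod Fract ` (?P \<times> ?P)"
      using gh by (force simp: is_reduced_def)
  qed
qed (simp add: finite_degree_le)

lemma is_reduced_factor:
  assumes red: "is_reduced (Fract g h) g0 h0" and h: "h \<noteq> 0"
  obtains m where "m \<noteq> 0" "g = m * g0" "h = m * h0"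
proof -
  have h0: "h0 \<noteq> 0" "coprime g0 h0" and eq: "g * h0 = g0 * h"
    using assms by (auto simp: is_reduced_def eq_fract)
  obtain u v where uv: "u * g0 + v * h0 = 1" using coprime_poly_bezout h0 by blast
  \<comment> \<open>The only possible cofactor: if \<open>g = m * g0\<close> and
    \<open>h = m * h0\<close>, the Bezout identity forces this value of \<open>m\<close>.\<close>
  define m where "m = u * g + v * h"
  have "h = (u * g0 + v * h0) * h" by (simp add: uv)
  also have "\<dots> = u * (g0 * h) + v * h * h0" by (simp only: algebra_simps)
  also have "\<dots> = m * h0" by (simp add: m_def algebra_simps flip: eq)
  finally have hm: "h = m * h0" .
  have "g * h0 = (m * g0) * h0" unfolding eq hm by (simp add: algebra_simps)
  then have "g = m * g0" using h0 by simp
  moreover have "m \<noteq> 0" using hm h by auto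
  ultimately show thesis using that hm by blast
qed

text \<open>Count the pairs \<open>(g, h)\<close> with \<open>h \<noteq> 0\<close> and both degrees at most \<open>d\<close> by the fraction they
  represent: those representing \<open>f\<close> are the nonzero multiples of the reduced pair of \<open>f\<close>.\<close>

lemma sum_card_rat_degree:
  fixes d :: nat
  defines "q \<equiv> card (UNIV :: 'a::{field,finite} set)"
  shows "(\<Sum>e\<le>d. card {f :: 'a poly fract. rat_degree f = e} * (q ^ Suc (d - e) - 1))
    = q ^ Suc d * (q ^ Suc d - 1)"
proof -
  obtain num den :: "'a poly fract \<Rightarrow> 'a poly" where red: "\<And>f. is_reduced f (num f) (den f)"
    using ex_reduced by metis
  have den: "den f \<noteq> 0" for f using red by (auto simp: is_reduced_def)
  have Fract: "Fract (m * num f) (m * den f) = f" if "m \<noteq> 0" for m f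
    using red[of f] that by (metis is_reduced_def mult_fract_cancel)
  \<comment> \<open>Multiplying the reduced pair of an expression of degree \<open>e\<close> by
    \<open>m\<close> gives maximal degree \<open>degree m + e\<close>, hence the bound
    \<open>d - e\<close> on the cofactor.\<close>
  define S where "S = (SIGMA e:{..d}. {f :: 'a poly fract. rat_degree f = e} \<times>
    {m :: 'a poly. m \<noteq> 0 \<and> degree m \<le> d - e})"
  define T where "T = {g :: 'a poly. degree g \<le> d} \<times> {h :: 'a poly. h \<noteq> 0 \<and> degree h \<le> d}"
  define F where "F = (\<lambda>(e :: nat, f, m). (m * num f, m * den f))"
  have "inj_on F S"
  proof (rule inj_onI)
    fix x y assume xy: "x \<in> S" "y \<in> S" "F x = F y"
    obtain e f m where x: "x = (e, f, m)" by (cases x)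
    obtain e' f' m' where y: "y = (e', f', m')" by (cases y)
    have m: "m \<noteq> 0" "m' \<noteq> 0" and e: "e = rat_degree f" "e' = rat_degree f'"
      using xy by (auto simp: x y S_def)
    have eq: "m * num f = m' * num f'" "m * den f = m' * den f'"
      using xy by (auto simp: x y F_def)
    have "f = f'" using Fract[OF m(1), of f] Fract[OF m(2), of f'] eq by simp
    then show "x = y" using eq(2) den[of f'] e by (simp add: x y)
  qed
  moreover have "F ` S = T"
  proof (intro equalityI subsetI)
    fix z assume "z \<in> F ` S"
    then obtain f m where m: "m \<noteq> 0" and le: "rat_degree f \<le> d" "degree m \<le> d - rat_degree f"
      and z: "z = (m * num f, m * den f)"
      by (auto simp: S_def F_def)
    have "degree (num f) \<le> rat_degree f" "degree (den f) \<le> rat_degree f"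
      by (simp_all add: rat_degree_eq[OF red])
    then have "degree (m * num f) \<le> d" "degree (m * den f) \<le> d"
      using le degree_mult_le[of m "num f"] degree_mult_le[of m "den f"] by linarith+
    then show "z \<in> T" using m den by (simp add: z T_def)
  next
    fix z assume "z \<in> T"
    then obtain g h where z: "z = (g, h)" and h: "h \<noteq> 0" and le: "degree g \<le> d" "degree h \<le> d"
      by (auto simp: T_def)
    define f where "f = Fract g h"
    obtain m where m: "m \<noteq> 0" "g = m * num f" "h = m * den f"
      using is_reduced_factor[of g h] red h unfolding f_def by blast
    have "degree m + degree (den f) \<le> d"
      using le(2) m den[of f] by (simp add: degree_mult_eq)
    \<comment> \<open>A zero numerator has degree 0 by convention, so its bound follows from the one
      for the denominator.\<close>
    moreover from this have "degree m + degree (num f) \<le> d"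
      using le(1) m by (cases "num f = 0") (simp_all add: degree_mult_eq)
    ultimately have "rat_degree f \<le> d" "degree m \<le> d - rat_degree f"
      by (simp_all add: rat_degree_eq[OF red])
    then have "(rat_degree f, f, m) \<in> S" using m by (simp add: S_def)
    moreover have "F (rat_degree f, f, m) = z" by (simp add: F_def z m(2) flip: m(3))
    ultimately show "z \<in> F ` S" by (metis imageI)
  qed
  ultimately have "card S = card T" by (metis card_image)
  moreover have "card S = (\<Sum>e\<le>d. card {f :: 'a poly fract. rat_degree f = e} * (q ^ Suc (d - e) - 1))"
    unfolding S_def
    by (subst card_SigmaI)
      (auto simp: finite_rat_degree_eq card_cartesian_product card_degree_le_nonzero q_def
        simp del: power_Suc intro!: finite_cartesian_product finite_subset[OF _ finite_degree_le])
  moreover have "card T = q ^ Suc d * (q ^ Suc d - 1)"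
    unfolding T_def card_cartesian_product card_degree_le card_degree_le_nonzero q_def ..
  ultimately show ?thesis by simp
qed

text \<open>For \<open>d = 0, 1, 2\<close> the counting identity is a triangular linear system for
  the numbers of expressions of degree 0, 1 and 2. It is solved over the integers, where subtraction
  is not truncated, by cancelling \<open>Q - 1\<close>.\<close>

lemma
  defines "q \<equiv> card (UNIV :: 'a::{field,finite} set)"
  shows card_rat_degree_1: "card {f :: 'a poly fract. rat_degree f = 1} = q * (q ^ 2 - 1)"
    and card_rat_degree_2: "card {f :: 'a poly fract. rat_degree f = 2} = q ^ 3 * (q ^ 2 - 1)"
proof -
  define N where "N = (\<lambda>e. int (card {f :: 'a poly fract. rat_degree f = e}))"
  define Q where "Q = int q"
  have "card {0, 1 :: 'a} \<le> q" unfolding q_def by (rule card_mono) simp_all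
  then have q: "q \<ge> 2" by simp
  then have Q: "Q - 1 \<noteq> 0" by (simp add: Q_def)
  have pow: "int (q ^ n - 1) = Q ^ n - 1" for n
    using q by (simp add: Q_def of_nat_diff)
  have count: "(\<Sum>e\<le>d. N e * (Q ^ Suc (d - e) - 1)) = Q ^ Suc d * (Q ^ Suc d - 1)" for d
  proof -
    have "(\<Sum>e\<le>d. N e * (Q ^ Suc (d - e) - 1))
        = int (\<Sum>e\<le>d. card {f :: 'a poly fract. rat_degree f = e} * (q ^ Suc (d - e) - 1))"
      by (simp only: of_nat_sum of_nat_mult pow N_def)
    also have "\<dots> = Q ^ Suc d * (Q ^ Suc d - 1)"
      unfolding q_def sum_card_rat_degree
      by (simp only: of_nat_mult of_nat_power pow[unfolded q_def] Q_def q_def)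
    finally show ?thesis .
  qed
  have 0: "N 0 = Q"
    using count[of 0] Q by simp
  have "N 1 * (Q - 1) = Q * (Q ^ 2 - 1) * (Q - 1)"
    using count[of 1] by (simp add: 0 algebra_simps power2_eq_square)
  then have 1: "N 1 = Q * (Q ^ 2 - 1)" using Q by simp
  have "Q * (Q ^ 3 - 1) + N 1 * (Q ^ 2 - 1) + N 2 * (Q - 1) = Q ^ 3 * (Q ^ 3 - 1)"
    using count[of 2] by (simp add: 0 numeral_2_eq_2 numeral_3_eq_3)
  then have "N 2 * (Q - 1) = Q ^ 3 * (Q ^ 2 - 1) * (Q - 1)"
    unfolding 1 by (simp add: algebra_simps power2_eq_square power3_eq_cube)
  then have 2: "N 2 = Q ^ 3 * (Q ^ 2 - 1)" using Q by simp
  have "int (card {f :: 'a poly fract. rat_degree f = 1}) = int (q * (q ^ 2 - 1))"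
    using 1 by (simp only: N_def of_nat_mult pow) (simp add: Q_def)
  then show "card {f :: 'a poly fract. rat_degree f = 1} = q * (q ^ 2 - 1)"
    by (simp only: of_nat_eq_iff)
  have "int (card {f :: 'a poly fract. rat_degree f = 2}) = int (q ^ 3 * (q ^ 2 - 1))"
    using 2 by (simp only: N_def of_nat_mult pow) (simp add: Q_def)
  then show "card {f :: 'a poly fract. rat_degree f = 2} = q ^ 3 * (q ^ 2 - 1)"
    by (simp only: of_nat_eq_iff)
qed

section \<open>The orbit of the square map\<close>

lemma quadratic_nonconst_eq_0_iff:
  assumes "s \<notin> range rat_const"
  shows "rat_const u * s ^ 2 + rat_const v * s + rat_const w = 0 \<longleftrightarrow> u = 0 \<and> v = 0 \<and> w = 0"
proof -
  have "eval_fract [:w, v, u:] s = rat_const u * s ^ 2 + rat_const v * s + rat_const w"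
    by (simp add: eval_fract_pCons algebra_simps power2_eq_square)
  then show ?thesis using eval_fract_neq_0[OF assms, of "[:w, v, u:]"] by auto
qed

lemma rat_X_power2_nonconst: "rat_X ^ 2 \<notin> range (rat_const :: 'a::field \<Rightarrow> _)"
proof
  assume "rat_X ^ 2 \<in> range (rat_const :: 'a \<Rightarrow> _)"
  then obtain c :: 'a where c: "rat_X ^ 2 = rat_const c" by auto
  have "rat_const (- c) = - rat_const c" using rat_const_diff[of 0 c] by simp
  then show False
    using quadratic_nonconst_eq_0_iff[OF rat_X_nonconst, of 1 0 "- c"] c by simp
qed

lemma to_fract_quadratic:
  "to_fract [:c, b, a:] = rat_const a * rat_X ^ 2 + rat_const b * rat_X + rat_const c"
  by (simp add: to_fract_pCons algebra_simps power2_eq_square)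

lemma rat_degree_compose_power2:
  assumes "rat_degree B = 1"
  shows "rat_degree (rat_compose B (rat_X ^ 2)) = 2"
proof -
  obtain a b c d where det: "a * d - b * c \<noteq> 0" and B: "B = mobius a b c d"
    using assms unfolding rat_degree_1_iff by blast
  \<comment> \<open>Eliminating the quadratic term leaves the determinant, as in degree one.\<close>
  have "smult (- c) [:b, 0, a:] + smult a [:d, 0, c:] = [:a * d - b * c:]"
    by (simp add: algebra_simps)
  then have "coprime [:b, 0, a:] [:d, 0, c:]"
    using det by (rule coprime_poly_if_combination_const)
  moreover have "[:d, 0, c:] \<noteq> 0" using det by auto
  moreover have "rat_compose (mobius a b c d) (rat_X ^ 2) = Fract [:b, 0, a:] [:d, 0, c:]"
    by (simp add: rat_compose_mobius rat_X_power2_nonconst Fract_conv_to_fract to_fract_quadratic)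
  ultimately have "is_reduced (rat_compose (mobius a b c d) (rat_X ^ 2)) [:b, 0, a:] [:d, 0, c:]"
    by (simp add: is_reduced_def)
  then show ?thesis using det by (auto simp: B rat_degree_eq)
qed

text \<open>Moebius substitutions can be moved past the Frobenius map \<open>x\<^sup>2\<close>, by squaring coefficients.\<close>

lemma rat_equiv_power2_iff:
  fixes f :: "'a::field poly fract"
  assumes char2: "(2 :: 'a) = 0"
  shows "rat_equiv f (rat_X ^ 2) \<longleftrightarrow> (\<exists>B. rat_degree B = 1 \<and> f = rat_compose B (rat_X ^ 2))"
proof
  assume "rat_equiv f (rat_X ^ 2)"
  then obtain B A where BA: "rat_degree B = 1" "rat_degree A = 1"
    "f = rat_compose B (rat_compose (rat_X ^ 2) A)"
    using rat_equivE rat_X_power2_nonconst by blast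
  obtain a b c d where A: "a * d - b * c \<noteq> 0" "A = mobius a b c d"
    using BA(2) unfolding rat_degree_1_iff by blast
  \<comment> \<open>In characteristic two the determinant of the squared coefficients is the square
    of the original one: the correction term carries a factor 2.\<close>
  have det: "a ^ 2 * d ^ 2 - b ^ 2 * c ^ 2 \<noteq> 0"
  proof -
    have "a ^ 2 * d ^ 2 - b ^ 2 * c ^ 2 = (a * d - b * c) * (a * d - b * c) + 2 * (b * c * (a * d - b * c))"
      by (simp add: algebra_simps power2_eq_square)
    then show ?thesis using A(1) by (simp only: char2) simp
  qed
  have two: "(2 :: 'a poly fract) = 0"
    by (simp add: char2 flip: rat_const_2)
  have "rat_compose (rat_X ^ 2) A = A ^ 2"
    using BA(2) by (simp add: rat_compose_power nonconst_if_rat_degree_1)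
  also have "\<dots> = rat_compose (mobius (a ^ 2) (b ^ 2) (c ^ 2) (d ^ 2)) (rat_X ^ 2)"
    unfolding A(2) rat_compose_mobius[OF rat_X_power2_nonconst]
    by (simp add: mobius_def power_divide power2_sum two rat_const_power power_mult_distrib)
  finally have "f = rat_compose B (rat_compose (mobius (a ^ 2) (b ^ 2) (c ^ 2) (d ^ 2)) (rat_X ^ 2))"
    using BA(3) by simp
  then have "f = rat_compose (rat_compose B (mobius (a ^ 2) (b ^ 2) (c ^ 2) (d ^ 2))) (rat_X ^ 2)"
    using det by (simp add: rat_compose_assoc rat_X_power2_nonconst mobius_nonconst)
  then show "\<exists>B. rat_degree B = 1 \<and> f = rat_compose B (rat_X ^ 2)"
    using BA(1) rat_degree_mobius[OF det] rat_degree_rat_compose_1 by blast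
next
  assume "\<exists>B. rat_degree B = 1 \<and> f = rat_compose B (rat_X ^ 2)"
  then show "rat_equiv f (rat_X ^ 2)"
    using rat_equivI[of _ rat_X "rat_X ^ 2"] rat_degree_rat_X by fastforce
qed

section \<open>Classification of quadratic expressions in characteristic two\<close>

lemma rat_compose_quadratic:
  assumes "s \<notin> range rat_const"
  shows "rat_compose (rat_const u * rat_X ^ 2 + rat_const v * rat_X + rat_const w) s
    = rat_const u * s ^ 2 + rat_const v * s + rat_const w"
  using assms by (simp add: rat_compose_add rat_compose_mult rat_compose_power)

lemma quadratic_polynomial_nonconst:
  assumes "u \<noteq> 0"
  shows "rat_const u * rat_X ^ 2 + rat_const v * rat_X + rat_const w \<notin> range rat_const"
proof
  assume "rat_const u * rat_X ^ 2 + rat_const v * rat_X + rat_const w \<in> range rat_const"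
  then obtain c where "rat_const u * rat_X ^ 2 + rat_const v * rat_X + rat_const w = rat_const c"
    by auto
  then have "rat_const u * rat_X ^ 2 + rat_const v * rat_X + rat_const (w - c) = 0"
    by (simp add: rat_const_diff algebra_simps)
  then show False using assms by (simp add: quadratic_nonconst_eq_0_iff rat_X_nonconst)
qed

lemma rat_X_power2_plus_rat_X_nonconst: "rat_X ^ 2 + rat_X \<notin> range rat_const"
  using quadratic_polynomial_nonconst[of 1 1 0] by simp

lemma quadratic_polynomial_rat_equiv:
  assumes u: "u \<noteq> 0" and v: "v \<noteq> 0"
  shows "rat_equiv (rat_const u * rat_X ^ 2 + rat_const v * rat_X + rat_const w) (rat_X ^ 2 + rat_X)"
proof -
  \<comment> \<open>Scaling the variable by \<open>u / v\<close> turns \<open>x^2 + x\<close> into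
    \<open>u / v^2\<close> times \<open>u x^2 + v x\<close>; \<open>B\<close> removes this factor
    and adds \<open>w\<close>.\<close>
  define A where "A = mobius (u / v) 0 0 1"
  define B where "B = mobius (v ^ 2 / u) w 0 1"
  have A: "rat_degree A = 1" and B: "rat_degree B = 1"
    unfolding A_def B_def by (intro rat_degree_mobius; use u v in simp)+
  have "rat_compose (rat_X ^ 2 + rat_X) A = A ^ 2 + A"
    using A by (simp add: rat_compose_add rat_compose_power nonconst_if_rat_degree_1)
  moreover have "A ^ 2 + A \<notin> range rat_const"
    using A rat_compose_nonconst[OF _ rat_X_power2_plus_rat_X_nonconst, of A] calculation
    by (simp add: nonconst_if_rat_degree_1)
  ultimately have "rat_compose B (rat_compose (rat_X ^ 2 + rat_X) A)
      = rat_const (v ^ 2 / u) * (A ^ 2 + A) + rat_const w"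
    by (simp add: B_def rat_compose_mobius)
  also have "\<dots> = rat_const u * rat_X ^ 2 + rat_const v * rat_X + rat_const w"
    using u v by (simp add: A_def mobius_def rat_const_divide rat_const_mult field_simps
        power2_eq_square)
  finally show ?thesis using rat_equivI[OF B A] by metis
qed

text \<open>Squaring is injective in characteristic two, hence surjective on a finite field.\<close>

lemma ex_sqrt_char2:
  assumes "(2 :: 'a::{field,finite}) = 0"
  shows "\<exists>y :: 'a. y ^ 2 = x"
proof -
  have "inj (\<lambda>y :: 'a. y ^ 2)"
  proof (rule injI)
    fix x y :: 'a assume "x ^ 2 = y ^ 2"
    then have "(x - y) ^ 2 = 2 * (y * (y - x))" by (simp add: power2_eq_square algebra_simps)
    then show "x = y" using assms by simp
  qed
  then have "surj (\<lambda>y :: 'a. y ^ 2)" by (simp add: finite_UNIV_inj_surj)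
  then show ?thesis by (metis surjD)
qed

text \<open>After subtracting \<open>k = b / e\<close>, the numerator is a square \<open>(\<alpha> x + \<gamma>)\<^sup>2\<close>, so \<open>1 / (f - k)\<close> has a
  single pole, which a Moebius substitution moves to infinity.\<close>

lemma separable_rat_equiv:
  fixes a b c d e r :: "'a::{field,finite}"
  defines "f \<equiv> (rat_const a * rat_X ^ 2 + rat_const b * rat_X + rat_const c)
    / (rat_const d * rat_X ^ 2 + rat_const e * rat_X + rat_const r)"
  assumes char2: "(2 :: 'a) = 0" and e: "e \<noteq> 0"
    and deg: "rat_degree f \<noteq> 0" "rat_degree f \<noteq> 1"
  shows "rat_equiv f (rat_X ^ 2 + rat_X)"
proof -
  \<comment> \<open>This choice makes the linear coefficient \<open>b - k * e\<close> of numerator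
    minus \<open>k\<close> times denominator vanish. The other two coefficients have square roots,
    and the cross term of the square \<open>L ^ 2\<close> vanishes in characteristic two.\<close>
  define k where "k = b / e"
  obtain \<alpha> \<gamma> where sq: "\<alpha> ^ 2 = a - k * d" "\<gamma> ^ 2 = c - k * r"
    using ex_sqrt_char2[OF char2] by metis
  define H where "H = rat_const d * rat_X ^ 2 + rat_const e * rat_X + rat_const r"
  define L where "L = rat_const \<alpha> * rat_X + rat_const \<gamma>"
  have H: "H \<noteq> 0" using e by (simp add: H_def quadratic_nonconst_eq_0_iff rat_X_nonconst)
  have "L ^ 2 = rat_const (\<alpha> ^ 2) * rat_X ^ 2 + rat_const (2 * \<alpha> * \<gamma>) * rat_X + rat_const (\<gamma> ^ 2)"
    by (simp add: L_def power2_sum rat_const_power rat_const_add power_mult_distrib mult_2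
        rat_const_mult rat_const_2 algebra_simps)
  also have "\<dots> = rat_const a * rat_X ^ 2 + rat_const b * rat_X + rat_const c - rat_const k * H"
  proof -
    have "b = k * e" using e by (simp add: k_def)
    then show ?thesis
      by (simp add: char2 sq H_def rat_const_diff rat_const_mult algebra_simps)
  qed
  finally have L2: "f = (L ^ 2 + rat_const k * H) / H" by (simp add: f_def H_def)
  have L: "L \<noteq> 0"
    using deg(1) H by (auto simp: L2 rat_degree_const_iff)
  \<comment> \<open>This is \<open>1 / (f - k)\<close>; the transformation \<open>k + 1 / x\<close>,
    written \<open>mobius k 1 1 0\<close>, recovers \<open>f\<close> from it.\<close>
  define f1 where "f1 = H / L ^ 2"
  have f1_nonconst: "f1 \<notin> range rat_const"
  proof
    assume "f1 \<in> range rat_const"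
    then obtain y where "f1 = rat_const y" by auto
    moreover from this have "y \<noteq> 0" using H L by (auto simp: f1_def)
    ultimately have "f = rat_const (1 / y + k)"
      using H L by (simp add: L2 f1_def rat_const_add rat_const_mult rat_const_divide field_simps)
    then show False using deg(1) by (simp add: rat_degree_const_iff)
  qed
  have M: "rat_degree (mobius k 1 1 0) = 1" by (rule rat_degree_mobius) simp
  have f: "f = rat_compose (mobius k 1 1 0) f1"
    unfolding rat_compose_mobius[OF f1_nonconst] using H L by (simp add: L2 f1_def field_simps)
  \<comment> \<open>The pole of \<open>f1\<close> is the zero of \<open>L\<close>. For
    \<open>\<alpha> = 0\<close> it already lies at infinity and \<open>f1\<close> is a polynomial;
    otherwise the new variable \<open>1 / L\<close> sends it there.\<close>
  obtain u v w A where A: "rat_degree A = 1" and v: "v \<noteq> 0"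
    and f1: "f1 = rat_const u * A ^ 2 + rat_const v * A + rat_const w"
  proof (cases "\<alpha> = 0")
    case True
    then have "\<gamma> \<noteq> 0" using L by (auto simp: L_def)
    show thesis
    proof (rule that[of rat_X "e / \<gamma> ^ 2" "d / \<gamma> ^ 2" "r / \<gamma> ^ 2"])
      show "f1 = rat_const (d / \<gamma> ^ 2) * rat_X ^ 2 + rat_const (e / \<gamma> ^ 2) * rat_X + rat_const (r / \<gamma> ^ 2)"
        by (simp add: f1_def L_def True H_def rat_const_divide rat_const_power add_divide_distrib)
    qed (use e \<open>\<gamma> \<noteq> 0\<close> in \<open>simp_all add: rat_degree_rat_X\<close>)
  next
    case False
    \<comment> \<open>Coefficients of \<open>H\<close> expanded in powers of \<open>L\<close>, found
      by comparing coefficients in characteristic two. Division by \<open>L ^ 2\<close> reverses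
      their order, so \<open>u\<close> becomes the leading one.\<close>
    define w where "w = d / \<alpha> ^ 2"
    define v where "v = e / \<alpha>"
    define u where "u = r - w * \<gamma> ^ 2 - v * \<gamma>"
    have "rat_const w * L ^ 2 + rat_const v * L + rat_const u
        = rat_const (w * \<alpha> ^ 2) * rat_X ^ 2 + rat_const (v * \<alpha> + 2 * (w * \<alpha> * \<gamma>)) * rat_X
          + rat_const (w * \<gamma> ^ 2 + v * \<gamma> + u)"
      by (simp add: L_def power2_sum rat_const_power rat_const_add power_mult_distrib mult_2
          rat_const_mult rat_const_2 algebra_simps)
    also have "\<dots> = H"
      using False by (simp add: char2 H_def w_def v_def u_def)
    finally have HL: "H = rat_const w * L ^ 2 + rat_const v * L + rat_const u" ..
    have "f1 = rat_const u * (1 / L) ^ 2 + rat_const v * (1 / L) + rat_const w"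
      using L by (simp add: f1_def HL field_simps power2_eq_square)
    moreover have "1 / L = mobius 0 1 \<alpha> \<gamma>" by (simp add: mobius_def L_def)
    moreover have "rat_degree (mobius 0 1 \<alpha> \<gamma>) = 1"
      using False by (intro rat_degree_mobius) simp
    moreover have "v \<noteq> 0" using e False by (simp add: v_def)
    ultimately show thesis using that by metis
  qed
  define P where "P = rat_const u * rat_X ^ 2 + rat_const v * rat_X + rat_const w"
  have f1P: "f1 = rat_compose P A"
    using A by (simp add: f1 P_def rat_compose_quadratic nonconst_if_rat_degree_1)
  \<comment> \<open>Otherwise \<open>f\<close> would be a composition of expressions of degree
    one.\<close>
  have "u \<noteq> 0"
  proof
    assume "u = 0"
    then have "P = mobius v w 0 1" by (simp add: P_def mobius_def)
    then have "rat_degree P = 1" using v by (simp add: rat_degree_mobius[of v 1 w 0, simplified])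
    then show False
      using deg(2) A M unfolding f f1P by (simp add: rat_degree_rat_compose_1)
  qed
  have "rat_equiv f P" unfolding f f1P by (rule rat_equivI[OF M A])
  moreover have "rat_equiv P (rat_X ^ 2 + rat_X)"
    unfolding P_def using \<open>u \<noteq> 0\<close> v by (rule quadratic_polynomial_rat_equiv)
  ultimately show ?thesis using rat_equiv_trans rat_X_power2_plus_rat_X_nonconst by blast
qed

lemma rat_degree_2_classification:
  fixes f :: "'a::{field,finite} poly fract"
  assumes char2: "(2 :: 'a) = 0" and deg: "rat_degree f = 2"
  shows "rat_equiv f (rat_X ^ 2) \<or> rat_equiv f (rat_X ^ 2 + rat_X)"
proof -
  obtain g h where gh: "is_reduced f g h" using ex_reduced by blast
  have quad: "\<exists>a b c. p = [:c, b, a:]" if "degree p \<le> 2" for p :: "'a poly"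
  proof -
    have "p = [:coeff p 0, coeff p 1, coeff p 2:]"
      using that
      by (intro poly_eqI) (auto simp: coeff_pCons coeff_eq_0 numeral_2_eq_2 split: nat.splits)
    then show ?thesis by blast
  qed
  from gh deg have "degree g \<le> 2" "degree h \<le> 2" by (auto simp: rat_degree_eq)
  then obtain a b c d e r where "g = [:c, b, a:]" "h = [:r, e, d:]" using quad by metis
  then have f: "f = (rat_const a * rat_X ^ 2 + rat_const b * rat_X + rat_const c)
    / (rat_const d * rat_X ^ 2 + rat_const e * rat_X + rat_const r)"
    using gh by (simp add: is_reduced_def Fract_conv_to_fract to_fract_quadratic)
  have nonconst: "f \<notin> range rat_const" using deg by (simp flip: rat_degree_const_iff)
  consider "b = 0" "e = 0" | "e \<noteq> 0" | "b \<noteq> 0" by blast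
  then show ?thesis
  proof cases
    case 1
    then have f': "f = (rat_const a * rat_X ^ 2 + rat_const c) / (rat_const d * rat_X ^ 2 + rat_const r)"
      using f by simp
    \<comment> \<open>A zero determinant would make \<open>f\<close>, a linear quotient in
      \<open>x^2\<close>, constant.\<close>
    then have "a * r - c * d \<noteq> 0" using nonconst linear_quotient_const by blast
    moreover have "f = rat_compose (mobius a c d r) (rat_X ^ 2)"
      by (simp add: f' rat_compose_mobius rat_X_power2_nonconst)
    ultimately show ?thesis
      using rat_equiv_power2_iff[OF char2] rat_degree_mobius by blast
  next
    case 2
    then show ?thesis using separable_rat_equiv[OF char2] deg f by simp
  next
    case 3
    \<comment> \<open>The inversion \<open>1 / x\<close> exchanges numerator and denominator, so
      that the nonzero linear coefficient \<open>b\<close> moves to the denominator.\<close>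
    define B where "B = mobius 0 1 1 (0 :: 'a)"
    have B: "rat_degree B = 1" unfolding B_def by (rule rat_degree_mobius) simp
    have inverse: "rat_compose B s = 1 / s" if "s \<notin> range rat_const" for s
      using that by (simp add: B_def rat_compose_mobius)
    have inv_nonconst: "1 / f \<notin> range rat_const"
      using rat_compose_nonconst[OF nonconst, of B] B
      by (simp add: inverse nonconst nonconst_if_rat_degree_1)
    have f_eq: "f = rat_compose B (1 / f)" by (simp add: inverse inv_nonconst)
    have "rat_degree (1 / f) \<noteq> 1"
      using rat_degree_rat_compose_1[OF B, of "1 / f"] deg f_eq by auto
    moreover have "rat_degree (1 / f) \<noteq> 0" using inv_nonconst by (simp add: rat_degree_const_iff)
    moreover have "1 / f = (rat_const d * rat_X ^ 2 + rat_const e * rat_X + rat_const r)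
        / (rat_const a * rat_X ^ 2 + rat_const b * rat_X + rat_const c)"
      by (simp add: f)
    ultimately have "rat_equiv (1 / f) (rat_X ^ 2 + rat_X)"
      using separable_rat_equiv[OF char2 3] by metis
    moreover have "rat_equiv f (1 / f)"
      using rat_equivI[OF B rat_degree_rat_X, of "1 / f"] f_eq by simp
    ultimately show ?thesis using rat_equiv_trans rat_X_power2_plus_rat_X_nonconst by blast
  qed
qed

section \<open>The representative \<open>(x^2 + 1) / x\<close> and the final count\<close>

lemma rat_degree_X_plus_inverse:
  "rat_degree ((rat_X ^ 2 + 1) / rat_X :: 'a::field poly fract) = 2"
proof -
  have "coprime [:1, 0, 1:] [:0, 1 :: 'a:]"
  proof (rule coprimeI)
    fix p :: "'a poly" assume "p dvd [:1, 0, 1:]" "p dvd [:0, 1:]"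
    \<comment> \<open>The difference \<open>x^2 + 1 - x * x\<close> is 1.\<close>
    then have "p dvd [:1, 0, 1:] - [:0, 1:] * [:0, 1:]" by (intro dvd_diff dvd_mult)
    then show "is_unit p" by (simp add: one_pCons)
  qed
  moreover have "(rat_X ^ 2 + 1) / rat_X = Fract [:1, 0, 1:] [:0, 1 :: 'a:]"
    by (simp add: Fract_conv_to_fract to_fract_quadratic to_fract_linear)
  ultimately have "is_reduced ((rat_X ^ 2 + 1) / rat_X) [:1, 0, 1:] [:0, 1 :: 'a:]"
    by (simp add: is_reduced_def)
  then show ?thesis by (simp add: rat_degree_eq)
qed

text \<open>Parity: after clearing denominators one side has only even powers of \<open>x\<close>
  and the other only odd ones, so all four coefficients vanish, against the nonzero
  determinant.\<close>

lemma X_plus_inverse_not_rat_equiv_power2: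
  assumes char2: "(2 :: 'a::field) = 0"
  shows "\<not> rat_equiv ((rat_X ^ 2 + 1) / rat_X) (rat_X ^ 2 :: 'a poly fract)"
proof
  assume "rat_equiv ((rat_X ^ 2 + 1) / rat_X) (rat_X ^ 2 :: 'a poly fract)"
  then obtain a b c d :: 'a where det: "a * d - b * c \<noteq> 0"
    and "(rat_X ^ 2 + 1) / rat_X = rat_compose (mobius a b c d) (rat_X ^ 2)"
    unfolding rat_equiv_power2_iff[OF char2] rat_degree_1_iff by blast
  then have "(rat_X ^ 2 + 1) / rat_X
      = (rat_const a * rat_X ^ 2 + rat_const b) / (rat_const c * rat_X ^ 2 + rat_const d)"
    by (simp add: rat_compose_mobius rat_X_power2_nonconst)
  moreover have "rat_const c * rat_X ^ 2 + rat_const d \<noteq> 0"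
    using det by (auto simp: linear_nonconst_eq_0_iff rat_X_power2_nonconst)
  moreover have "rat_X \<noteq> (0 :: 'a poly fract)" by (simp add: rat_X_def)
  ultimately have "(rat_X ^ 2 + 1) * (rat_const c * rat_X ^ 2 + rat_const d)
      = (rat_const a * rat_X ^ 2 + rat_const b) * rat_X"
    by (simp add: frac_eq_eq)
  then have "to_fract ([:1, 0, 1:] * [:d, 0, c:]) = to_fract ([:b, 0, a:] * [:0, 1:])"
    by (simp only: to_fract_mult to_fract_quadratic to_fract_linear) simp
  then have "[:1, 0, 1:] * [:d, 0, c:] = [:b, 0, a:] * [:0, 1:]"
    by (simp only: to_fract_eq_iff)
  then show False using det by simp
qed

text \<open>Being quadratic and outside the orbit of \<open>x^2\<close>, the expression
  \<open>(x^2 + 1) / x\<close> is equivalent to \<open>x^2 + x\<close> by the classification and can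
  replace it as representative. Disjointness of the two classes follows by symmetry and
  transitivity.\<close>

lemma rat_equiv_X_plus_inverse_iff:
  fixes f :: "'a::{field,finite} poly fract"
  assumes char2: "(2 :: 'a) = 0" and deg: "rat_degree f = 2"
  shows "rat_equiv f ((rat_X ^ 2 + 1) / rat_X) \<longleftrightarrow> \<not> rat_equiv f (rat_X ^ 2)"
proof
  assume "rat_equiv f ((rat_X ^ 2 + 1) / rat_X)"
  then show "\<not> rat_equiv f (rat_X ^ 2)"
    using X_plus_inverse_not_rat_equiv_power2[OF char2] rat_equiv_sym rat_equiv_trans
      rat_X_power2_nonconst by metis
next
  assume "\<not> rat_equiv f (rat_X ^ 2)"
  then have "rat_equiv f (rat_X ^ 2 + rat_X)"
    using rat_degree_2_classification[OF char2 deg] by blast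
  moreover have "rat_equiv (rat_X ^ 2 + rat_X) ((rat_X ^ 2 + 1) / rat_X :: 'a poly fract)"
    using rat_degree_2_classification[OF char2 rat_degree_X_plus_inverse]
      X_plus_inverse_not_rat_equiv_power2[OF char2] rat_equiv_sym by blast
  moreover have "(rat_X ^ 2 + 1) / rat_X \<notin> (range rat_const :: 'a poly fract set)"
    by (simp add: rat_degree_X_plus_inverse flip: rat_degree_const_iff)
  ultimately show "rat_equiv f ((rat_X ^ 2 + 1) / rat_X)"
    using rat_equiv_trans by blast
qed

theorem theorem3p2:
  fixes q :: nat
  assumes "CHAR('a::{field,finite}) = 2"
    and "q = card (UNIV :: 'a set)"
  shows "card {f :: 'a poly fract. rat_degree f = 2} = q ^ 3 * (q ^ 2 - 1) \<and>
         card {f :: 'a poly fract. rat_degree f = 2 \<and> rat_equiv f (rat_X ^ 2)}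
           = q * (q ^ 2 - 1) \<and>
         card {f :: 'a poly fract. rat_degree f = 2 \<and> rat_equiv f ((rat_X ^ 2 + 1) / rat_X)}
           = q * (q ^ 2 - 1) ^ 2"
proof -
  have char2: "(2 :: 'a) = 0"
    using of_nat_CHAR[where 'a = 'a] assms(1) by simp
  let ?D = "{f :: 'a poly fract. rat_degree f = 2}"
  let ?S = "{f :: 'a poly fract. rat_degree f = 2 \<and> rat_equiv f (rat_X ^ 2)}"
  let ?T = "{f :: 'a poly fract. rat_degree f = 2 \<and> rat_equiv f ((rat_X ^ 2 + 1) / rat_X)}"
  have D: "card ?D = q ^ 3 * (q ^ 2 - 1)"
    using card_rat_degree_2[where 'a = 'a] assms(2) by simp
  \<comment> \<open>Substituting \<open>x^2\<close> is injective, so this image has as many elements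
    as there are expressions of degree one.\<close>
  have "?S = (\<lambda>B. rat_compose B (rat_X ^ 2)) ` {B. rat_degree B = 1}"
    using rat_degree_compose_power2 unfolding rat_equiv_power2_iff[OF char2] by blast
  moreover have "inj (\<lambda>B :: 'a poly fract. rat_compose B (rat_X ^ 2))"
    by (rule injI) (simp add: rat_compose_inject rat_X_power2_nonconst)
  ultimately have S: "card ?S = q * (q ^ 2 - 1)"
    using card_rat_degree_1[where 'a = 'a] assms(2)
    by (simp add: card_image inj_on_subset[OF _ subset_UNIV])
  have "?T = ?D - ?S" using rat_equiv_X_plus_inverse_iff[OF char2] by blast
  then have "card ?T = card ?D - card ?S"
    by (simp only:) (rule card_Diff_subset, auto intro: finite_subset[OF _ finite_rat_degree_eq[of 2]])
  \<comment> \<open>The common factor \<open>q * (q ^ 2 - 1)\<close> of both counts leaves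
    \<open>q ^ 2 - 1\<close>.\<close>
  also have "\<dots> = q * (q ^ 2 - 1) ^ 2"
    unfolding D S
    by (simp add: power2_eq_square power3_eq_cube algebra_simps diff_mult_distrib diff_mult_distrib2)
  finally show ?thesis using D S by blast
qed

end
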